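(* There exists a Heffter array $H(n;k)$ for all $n\equiv 3\pmod 4$ and $k\equiv 3\pmod 4$ with $n>k\ge 3$.
   Context: A Heffter array $H(n;k)$ is an $n\times n$ array in which some cells are filled with nonzero integers and the others are empty, such that: each row and each column contains exactly $k$ filled cells; the entries of every row and of every column sum to $0$ modulo $2nk+1$; and for each integer $1\le x\le nk$, exactly one of $x$ or $-x$ appears in the array, and it appears exactly once. *)

theory Defs
  imports Main
begin

text \<open>An n x n partially filled array: cell (i,j) with i,j < n is empty (None)
  or filled with an integer (Some x). Values outside the index range are ignored.\<close>

definition filled_row :: "nat \<Rightarrow> (nat \<Rightarrow> nat \<Rightarrow> int option) \<Rightarrow> nat \<Rightarrow> nat set" where
  "filled_row n A i = {j. j < n \<and> A i j \<noteq> None}"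

definition filled_col :: "nat \<Rightarrow> (nat \<Rightarrow> nat \<Rightarrow> int option) \<Rightarrow> nat \<Rightarrow> nat set" where
  "filled_col n A j = {i. i < n \<and> A i j \<noteq> None}"

definition entry :: "int option \<Rightarrow> int" where
  "entry c = (case c of None \<Rightarrow> 0 | Some x \<Rightarrow> x)"

definition is_heffter :: "nat \<Rightarrow> nat \<Rightarrow> (nat \<Rightarrow> nat \<Rightarrow> int option) \<Rightarrow> bool" where
  "is_heffter n k A \<longleftrightarrow>
     (\<forall>i<n. card (filled_row n A i) = k) \<and>
     (\<forall>j<n. card (filled_col n A j) = k) \<and>
     (\<forall>i<n. \<forall>j<n. A i j \<noteq> Some 0) \<and>
     (\<forall>i<n. \<forall>j<n. \<forall>x. A i j = Some x \<longrightarrow> \<bar>x\<bar> \<le> int n * int k) \<and>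
     (\<forall>i<n. (\<Sum>j<n. entry (A i j)) mod (2 * int n * int k + 1) = 0) \<and>
     (\<forall>j<n. (\<Sum>i<n. entry (A i j)) mod (2 * int n * int k + 1) = 0) \<and>
     (\<forall>x::int. 1 \<le> x \<and> x \<le> int n * int k \<longrightarrow>
        (\<exists>!p. p \<in> {..<n} \<times> {..<n} \<and>
              (A (fst p) (snd p) = Some x \<or> A (fst p) (snd p) = Some (- x))))"

end

theory Submission
  imports Defs
begin

text \<open>
  Only cells of \<open>k\<close> cyclically consecutive diagonals are filled; put \<open>N = n * k\<close>.

  Modulo \<open>2 * N + 1\<close>, doubling sends \<open>x\<close> to \<open>2 * x\<close> and \<open>N - y\<close> to \<open>-(2 * y + 1)\<close>, so small and
  large entries become even and odd numbers whose lines can sum to \<open>0\<close> over the integers. If cells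
  \<open>(i, i)\<close>, \<open>(i, i + 1)\<close>, \<open>(i, i + 2)\<close> hold \<open>a\<^sub>i\<close>, \<open>b\<^sub>i\<close>, \<open>c\<^sub>i\<close> after doubling, then all lines sum to \<open>0\<close>
  iff \<open>a\<^sub>i = c\<^sub>i\<^sub>-\<^sub>1 + C\<close> and \<open>b\<^sub>i = -(c\<^sub>i + c\<^sub>i\<^sub>-\<^sub>1 + C)\<close> for a constant \<open>C\<close>. Take \<open>C = 4 * n - 1\<close> and
  let \<open>c\<^sub>i\<close> be alternately \<open>-(2 * \<pi>\<^sub>i + 1)\<close> and \<open>-(4 * n - 2 - 2 * \<pi>\<^sub>i)\<close> for a permutation \<open>\<pi>\<close> of
  \<open>0, \<dots>, n - 1\<close>. Up to sign, the \<open>a\<^sub>i\<close> and \<open>c\<^sub>i\<close> are then the doubles of \<open>n, \<dots>, 2 * n - 1\<close> and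
  \<open>N - n + 1, \<dots>, N\<close>, and the \<open>b\<^sub>i\<close> with \<open>i > 0\<close> are the doubles of the differences of consecutive
  \<open>\<pi>\<^sub>i\<close>. If these differences are \<open>1, \<dots>, n - 1\<close> (a graceful path) and the end labels of the path sum
  to \<open>n - 2\<close>, then \<open>b\<^sub>0\<close> is the double of \<open>N - n\<close>, and the three diagonals use exactly
  \<open>1, \<dots>, 2 * n - 1\<close> and \<open>N - n, \<dots>, N\<close>. For \<open>n = 4 * h - 1\<close> two zigzags form such a path.

  The other values are split into intervals of length \<open>2 * n\<close>, each written with alternating signs
  along the staircase formed by two adjacent diagonals. Such a pair has line sums independent of
  the interval, so the contributions of two pairs with opposite signs cancel.
\<close>

section \<open>Arrays filled along cyclic diagonals\<close>

definition diagonal_array :: "nat \<Rightarrow> nat \<Rightarrow> (nat \<Rightarrow> nat \<Rightarrow> int) \<Rightarrow> nat \<Rightarrow> nat \<Rightarrow> int option" where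
  "diagonal_array n k f i j =
     (if (j + n - i) mod n < k then Some (f i ((j + n - i) mod n)) else None)"

lemma diagonal_shift:
  fixes i d n :: nat
  assumes "i < n" "d < n"
  shows "((i + d) mod n + n - i) mod n = d"
  using assms by (cases "i + d < n") (auto simp: mod_if)

lemma diagonal_unshift:
  fixes i j n :: nat
  assumes "i < n" "j < n"
  shows "(i + (j + n - i) mod n) mod n = j"
  using assms by (cases "i \<le> j") (auto simp: mod_if)

lemma diagonal_unshift_row:
  fixes d j n :: nat
  assumes "d < n" "j < n"
  shows "((j + n - d) mod n + d) mod n = j"
  using diagonal_unshift[OF assms] by (simp add: add.commute)

lemma diagonal_shift_row:
  fixes i j n :: nat
  assumes "i < n" "j < n"
  shows "(j + n - (j + n - i) mod n) mod n = i"
proof (cases "i \<le> j")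
  case True
  then have "(j + n - i) mod n = j - i"
    using assms by (simp add: mod_if)
  then show ?thesis
    using True assms by simp
next
  case False
  then have "(j + n - i) mod n = j + n - i"
    using assms by (intro mod_less) simp
  then show ?thesis
    using False assms by simp
qed

lemma filled_row_diagonal_array:
  assumes "i < n" "k \<le> n"
  shows "bij_betw (\<lambda>d. (i + d) mod n) {..<k} (filled_row n (diagonal_array n k f) i)"
  by (rule bij_betw_byWitness[where f' = "\<lambda>j. (j + n - i) mod n"])
    (use assms in \<open>auto simp: filled_row_def diagonal_array_def diagonal_shift diagonal_unshift
      split: if_splits\<close>)

lemma filled_col_diagonal_array:
  assumes "j < n" "k \<le> n"
  shows "bij_betw (\<lambda>d. (j + n - d) mod n) {..<k} (filled_col n (diagonal_array n k f) j)"
  by (rule bij_betw_byWitness[where f' = "\<lambda>i. (j + n - i) mod n"])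
    (use assms in \<open>auto simp: filled_col_def diagonal_array_def diagonal_shift_row
      split: if_splits\<close>)

lemma sum_row_diagonal_array:
  assumes "i < n" "k \<le> n"
  shows "(\<Sum>j<n. entry (diagonal_array n k f i j)) = (\<Sum>d<k. f i d)"
proof -
  let ?A = "diagonal_array n k f"
  have "(\<Sum>j<n. entry (?A i j)) = (\<Sum>j\<in>filled_row n ?A i. entry (?A i j))"
    by (rule sum.mono_neutral_right) (auto simp: filled_row_def entry_def)
  also have "\<dots> = (\<Sum>d<k. entry (?A i ((i + d) mod n)))"
    by (rule sum.reindex_bij_betw[OF filled_row_diagonal_array[OF assms], symmetric])
  also have "\<dots> = (\<Sum>d<k. f i d)"
    by (rule sum.cong) (use assms in \<open>auto simp: diagonal_array_def diagonal_shift entry_def\<close>)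
  finally show ?thesis .
qed

lemma sum_col_diagonal_array:
  assumes "j < n" "k \<le> n"
  shows "(\<Sum>i<n. entry (diagonal_array n k f i j)) = (\<Sum>d<k. f ((j + n - d) mod n) d)"
proof -
  let ?A = "diagonal_array n k f"
  have "(\<Sum>i<n. entry (?A i j)) = (\<Sum>i\<in>filled_col n ?A j. entry (?A i j))"
    by (rule sum.mono_neutral_right) (auto simp: filled_col_def entry_def)
  also have "\<dots> = (\<Sum>d<k. entry (?A ((j + n - d) mod n) j))"
    by (rule sum.reindex_bij_betw[OF filled_col_diagonal_array[OF assms], symmetric])
  also have "\<dots> = (\<Sum>d<k. f ((j + n - d) mod n) d)"
    by (rule sum.cong) (use assms in \<open>auto simp: diagonal_array_def diagonal_shift_row entry_def\<close>)
  finally show ?thesis .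
qed

text \<open>A counting argument makes surjectivity suffice: only \<open>n * k\<close> cells are
  filled, so reaching all \<open>n * k\<close> values forces the absolute values to be a bijection.
  This gives both the bound on the entries and uniqueness.\<close>

lemma is_heffter_diagonal_array:
  fixes n k :: nat and f :: "nat \<Rightarrow> nat \<Rightarrow> int"
  assumes "k \<le> n"
    and row: "\<And>i. i < n \<Longrightarrow> (\<Sum>d<k. f i d) mod (2 * int n * int k + 1) = 0"
    and col: "\<And>j. j < n \<Longrightarrow> (\<Sum>d<k. f ((j + n - d) mod n) d) mod (2 * int n * int k + 1) = 0"
    and surj: "\<And>x. 1 \<le> x \<Longrightarrow> x \<le> int n * int k \<Longrightarrow> \<exists>i<n. \<exists>d<k. \<bar>f i d\<bar> = x"
  shows "is_heffter n k (diagonal_array n k f)"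
proof -
  let ?A = "diagonal_array n k f"
  define S where "S = {..<n} \<times> {..<k}"
  define g where "g = (\<lambda>(i, d). \<bar>f i d\<bar>)"
  have fin: "finite S" and card: "card S = n * k"
    by (auto simp: S_def)
  have sub: "{1..int n * int k} \<subseteq> g ` S"
    using surj by (force simp: S_def g_def)
  have card_int: "card {1..int n * int k} = n * k"
    by (simp flip: of_nat_mult)
  have img: "{1..int n * int k} = g ` S"
    by (rule card_seteq) (use fin sub card card_int card_image_le[OF fin, of g] in auto)
  have inj: "inj_on g S"
    by (rule eq_card_imp_inj_on) (use fin card card_int img in auto)
  have filled: "(i, (j + n - i) mod n) \<in> S \<and> y = f i ((j + n - i) mod n)"
    if "i < n" "j < n" "?A i j = Some y" for i j y
    using that by (auto simp: diagonal_array_def S_def split: if_splits)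
  have range: "1 \<le> \<bar>y\<bar> \<and> \<bar>y\<bar> \<le> int n * int k" if "i < n" "j < n" "?A i j = Some y" for i j y
  proof -
    have "\<bar>y\<bar> \<in> g ` S"
      using filled[OF that] by (force simp: g_def)
    then show ?thesis
      using img by auto
  qed
  have uniq: "\<exists>!p. p \<in> {..<n} \<times> {..<n} \<and>
      (?A (fst p) (snd p) = Some x \<or> ?A (fst p) (snd p) = Some (- x))"
    if x: "1 \<le> x" "x \<le> int n * int k" for x
  proof (rule ex_ex1I)
    obtain i d where id: "i < n" "d < k" "\<bar>f i d\<bar> = x"
      using surj[OF x] by auto
    then have "?A i ((i + d) mod n) = Some (f i d)"
      using \<open>k \<le> n\<close> by (simp add: diagonal_array_def diagonal_shift)
    moreover have "f i d = x \<or> f i d = - x"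
      using id by auto
    ultimately show "\<exists>p. p \<in> {..<n} \<times> {..<n} \<and>
        (?A (fst p) (snd p) = Some x \<or> ?A (fst p) (snd p) = Some (- x))"
      using id by (intro exI[of _ "(i, (i + d) mod n)"]) auto
  next
    fix p q
    assume p: "p \<in> {..<n} \<times> {..<n} \<and>
        (?A (fst p) (snd p) = Some x \<or> ?A (fst p) (snd p) = Some (- x))"
      and q: "q \<in> {..<n} \<times> {..<n} \<and>
        (?A (fst q) (snd q) = Some x \<or> ?A (fst q) (snd q) = Some (- x))"
    have *: "(fst r, (snd r + n - fst r) mod n) \<in> S \<and> g (fst r, (snd r + n - fst r) mod n) = x"
      if "r \<in> {..<n} \<times> {..<n} \<and>
        (?A (fst r) (snd r) = Some x \<or> ?A (fst r) (snd r) = Some (- x))" for r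
      using that filled[of "fst r" "snd r" x] filled[of "fst r" "snd r" "- x"] x
      by (auto simp: g_def)
    have eq: "fst p = fst q" "(snd p + n - fst p) mod n = (snd q + n - fst q) mod n"
      using inj *[OF p] *[OF q] by (auto dest!: inj_onD)
    moreover have "snd r = (fst r + (snd r + n - fst r) mod n) mod n"
      if "r \<in> {..<n} \<times> {..<n}" for r
      using that diagonal_unshift[of "fst r" n "snd r"] by auto
    ultimately show "p = q"
      using p q by (metis prod.collapse)
  qed
  have card_row: "card (filled_row n ?A i) = k" if "i < n" for i
    using bij_betw_same_card[OF filled_row_diagonal_array[OF that \<open>k \<le> n\<close>, of f]] by simp
  have card_col: "card (filled_col n ?A j) = k" if "j < n" for j
    using bij_betw_same_card[OF filled_col_diagonal_array[OF that \<open>k \<le> n\<close>, of f]] by simp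
  show ?thesis
    unfolding is_heffter_def
  proof (intro conjI allI impI)
    fix i j assume "i < n" "j < n"
    then show "?A i j \<noteq> Some 0"
      using range[of i j 0] by auto
  qed (use card_row card_col range uniq row col \<open>k \<le> n\<close> in
      \<open>auto simp: sum_row_diagonal_array sum_col_diagonal_array\<close>)
qed

section \<open>A graceful labelling of a path\<close>

text \<open>The first zigzag runs through the labels \<open>h - 1\<close> down to \<open>0\<close>
  and \<open>3 * h - 1\<close> up to \<open>4 * h - 2\<close>, the second through those in between.
  The successive differences are \<open>2 * h\<close> up to \<open>4 * h - 2\<close>, then
  \<open>2 * h - 1\<close> at the junction, then \<open>1\<close> up to
  \<open>2 * h - 2\<close>.\<close>

definition graceful_path :: "nat \<Rightarrow> nat \<Rightarrow> int" where
  "graceful_path h i =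
     (if i < 2 * h then (if even i then int h - 1 - int (i div 2) else 3 * int h - 1 + int (i div 2))
      else (if even i then int h - 1 + int (i div 2) else 3 * int h - 2 - int (i div 2)))"

lemma graceful_path_surj:
  fixes p :: int
  assumes "0 \<le> p" "p < 4 * int h - 1"
  shows "\<exists>i < 4 * h - 1. graceful_path h i = p"
proof -
  consider "p < int h" | "int h \<le> p" "p \<le> 2 * int h - 2"
    | "2 * int h - 1 \<le> p" "p \<le> 3 * int h - 2" | "3 * int h - 1 \<le> p"
    by linarith
  then show ?thesis
  proof cases
    case 1
    then show ?thesis
      using assms by (intro exI[of _ "2 * nat (int h - 1 - p)"]) (auto simp: graceful_path_def)
  next
    case 2
    then show ?thesis
      using assms by (intro exI[of _ "2 * nat (3 * int h - 2 - p) + 1"])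
        (auto simp: graceful_path_def)
  next
    case 3
    then show ?thesis
      using assms by (intro exI[of _ "2 * nat (p - int h + 1)"]) (auto simp: graceful_path_def)
  next
    case 4
    then show ?thesis
      using assms by (intro exI[of _ "2 * nat (p - 3 * int h + 1) + 1"])
        (auto simp: graceful_path_def)
  qed
qed

lemma graceful_path_differences:
  fixes x :: int
  assumes "1 \<le> x" "x < 4 * int h - 1"
  shows "\<exists>i < 4 * h - 1. 0 < i \<and> \<bar>graceful_path h i - graceful_path h (i - 1)\<bar> = x"
proof -
  \<comment> \<open>The branches locate the difference \<open>x\<close> in the second zigzag, at the
    junction and in the first zigzag.\<close>
  define i where "i = (if x < 2 * int h - 1 then 2 * h + nat x
    else if x = 2 * int h - 1 then 2 * h else nat x + 1 - 2 * h)"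
  have "i < 4 * h - 1" "0 < i"
    using assms by (auto simp: i_def)
  moreover have "\<bar>graceful_path h i - graceful_path h (i - 1)\<bar> = x"
  proof (cases "even i")
    case True
    then obtain t where t: "i = 2 * t"
      by auto
    then have "(i - 1) div 2 = t - 1" "odd (i - 1)"
      using \<open>0 < i\<close> by auto
    moreover have "0 < t"
      using t \<open>0 < i\<close> by simp
    moreover have "x < 2 * int h - 1 \<and> 2 * int t = 2 * int h + x \<or> x = 2 * int h - 1 \<and> t = h \<or>
        2 * int h \<le> x \<and> 2 * int t = x + 1 - 2 * int h"
      using t assms unfolding i_def by (simp split: if_splits; linarith)
    ultimately show ?thesis
      using assms t by (auto simp: graceful_path_def)
  next
    case False
    then obtain t where t: "i = 2 * t + 1"
      using oddE by blast
    have "x \<noteq> 2 * int h - 1"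
      using False by (auto simp: i_def)
    then show ?thesis
      using assms t by (auto simp: graceful_path_def i_def split: if_splits)
  qed
  ultimately show ?thesis
    by blast
qed

lemma graceful_path_ends:
  assumes "0 < h"
  shows "graceful_path h 0 + graceful_path h (4 * h - 2) = 4 * int h - 3"
proof -
  have "4 * h - 2 = 2 * (2 * h - 1)"
    by simp
  then show ?thesis
    using assms by (simp add: graceful_path_def)
qed

section \<open>The entries and their line sums\<close>

text \<open>Offsets \<open>0\<close>, \<open>1\<close>, \<open>2\<close> carry the three basic
  diagonals with the doubling undone. Later offsets form pairs \<open>3 + 2 * w\<close>,
  \<open>4 + 2 * w\<close>, where \<open>w = (d - 3) div 2\<close> numbers the interval. Within it,
  the position is twice the column of the row's cell at offset \<open>3 + 2 * w\<close>, plus 1 on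
  the second diagonal.\<close>

definition heffter_entry :: "nat \<Rightarrow> nat \<Rightarrow> (nat \<Rightarrow> int) \<Rightarrow> nat \<Rightarrow> nat \<Rightarrow> int" where
  "heffter_entry n k \<pi> i d =
     (if d = 0 then
        (let l = (i + n - 1) mod n in
         if even l then 2 * int n - 1 - \<pi> l else \<pi> l - int n * int k)
      else if d = 1 then
        (if i = 0 then int n * int k - int n
         else if even i then \<pi> i - \<pi> (i - 1) else \<pi> (i - 1) - \<pi> i)
      else if d = 2 then
        (if even i then int n * int k - \<pi> i else \<pi> i - (2 * int n - 1))
      else if odd d then
        (-1) ^ ((d - 3) div 2) *
          int (2 * n + 2 * n * ((d - 3) div 2) + 2 * ((i + d) mod n))
      else
        - ((-1) ^ ((d - 3) div 2)) *
          int (2 * n + 2 * n * ((d - 3) div 2) + 2 * ((i + d - 1) mod n) + 1))"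

lemma heffter_entry_staircase_eq:
  "heffter_entry n k \<pi> i (3 + 2 * w) =
     (-1) ^ w * int (2 * n + 2 * n * w + 2 * ((i + (3 + 2 * w)) mod n))"
  "heffter_entry n k \<pi> i (4 + 2 * w) =
     - ((-1) ^ w) * int (2 * n + 2 * n * w + 2 * ((i + (3 + 2 * w)) mod n) + 1)"
proof -
  have "(4 + 2 * w - 3) div 2 = w" "i + (4 + 2 * w) - 1 = i + (3 + 2 * w)"
    by simp_all
  then show "heffter_entry n k \<pi> i (4 + 2 * w) =
     - ((-1) ^ w) * int (2 * n + 2 * n * w + 2 * ((i + (3 + 2 * w)) mod n) + 1)"
    unfolding heffter_entry_def by (simp add: add.left_commute)
qed (simp add: heffter_entry_def)

text \<open>Here \<open>k\<close> being 3 modulo 4 matters: the number of pairs is even, so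
  neighbouring pairs cancel.\<close>

lemma sum_alternating_pairs:
  fixes g :: "nat \<Rightarrow> int"
  assumes "\<And>w. w < 2 * p \<Longrightarrow> g (3 + 2 * w) + g (4 + 2 * w) = (-1) ^ w * c"
  shows "(\<Sum>d<3 + 4 * p. g d) = g 0 + g 1 + g 2"
  using assms
proof (induction p)
  case 0
  then show ?case
    by (simp add: numeral_eq_Suc)
next
  case (Suc p)
  have "(\<Sum>d<3 + 4 * Suc p. g d) =
      (\<Sum>d<3 + 4 * p. g d) + g (3 + 4 * p) + g (4 + 4 * p) + g (5 + 4 * p) + g (6 + 4 * p)"
    by (simp add: numeral_eq_Suc)
  moreover have "g (3 + 4 * p) + g (4 + 4 * p) = c"
    using Suc.prems[of "2 * p"] by simp
  moreover have "g (5 + 4 * p) + g (6 + 4 * p) = - c"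
    using Suc.prems[of "2 * p + 1"] by simp
  moreover have "(\<Sum>d<3 + 4 * p. g d) = g 0 + g 1 + g 2"
    using Suc by simp
  ultimately show ?case
    by simp
qed

text \<open>In a row, a pair holds consecutive values with opposite signs. The other three entries
  cancel exactly, except in row \<open>0\<close>, where the sum of the end labels produces the
  modulus.\<close>

lemma sum_heffter_entry_row:
  assumes "odd n" "i < n" "\<pi> 0 + \<pi> (n - 1) = int n - 2" "k = 3 + 4 * p"
  shows "(\<Sum>d<k. heffter_entry n k \<pi> i d) = (if i = 0 then 2 * int n * int k + 1 else 0)"
proof -
  have "(\<Sum>d<k. heffter_entry n k \<pi> i d) =
      heffter_entry n k \<pi> i 0 + heffter_entry n k \<pi> i 1 + heffter_entry n k \<pi> i 2"
    unfolding assms(4)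
    by (rule sum_alternating_pairs[where c = "-1"], unfold heffter_entry_staircase_eq)
      (simp add: algebra_simps)
  also have "\<dots> = (if i = 0 then 2 * int n * int k + 1 else 0)"
  proof (cases "i = 0")
    case True
    then show ?thesis
      using assms(1-3) by (simp add: heffter_entry_def)
  next
    case False
    then have "(i + n - 1) mod n = i - 1"
      using assms(2) by (simp add: mod_if)
    then show ?thesis
      using False by (simp add: heffter_entry_def)
  qed
  finally show ?thesis .
qed

text \<open>In a column, a pair compares the positions of \<open>j\<close> and its cyclic
  predecessor. Wrapping at \<open>j = 0\<close> changes the difference, but it stays independent of
  \<open>w\<close>. Column \<open>1\<close> is exceptional because it contains the special cell
  \<open>(0, 1)\<close>.\<close>

lemma sum_heffter_entry_col:
  assumes "odd n" "j < n" "\<pi> 0 + \<pi> (n - 1) = int n - 2" "k = 3 + 4 * p" "k \<le> n"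
  shows "(\<Sum>d<k. heffter_entry n k \<pi> ((j + n - d) mod n) d) =
    (if j = 1 then 2 * int n * int k + 1 else 0)"
proof -
  have pair: "heffter_entry n k \<pi> ((j + n - (3 + 2 * w)) mod n) (3 + 2 * w) +
      heffter_entry n k \<pi> ((j + n - (4 + 2 * w)) mod n) (4 + 2 * w) =
      (-1) ^ w * (2 * int j - 2 * int ((j + n - 1) mod n) - 1)" if "w < 2 * p" for w
  proof -
    have "((j + n - (3 + 2 * w)) mod n + (3 + 2 * w)) mod n = j"
      using that assms by (intro diagonal_unshift_row) auto
    moreover have "((j + n - (4 + 2 * w)) mod n + (3 + 2 * w)) mod n = (j + n - 1) mod n"
    proof -
      have "j + n - (4 + 2 * w) + (3 + 2 * w) = j + n - 1"
        using that assms(4,5) by simp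
      then show ?thesis
        by (metis mod_add_left_eq)
    qed
    ultimately show ?thesis
      unfolding heffter_entry_staircase_eq by (simp only:) (simp add: algebra_simps)
  qed
  have "(\<Sum>d<k. heffter_entry n k \<pi> ((j + n - d) mod n) d) =
      heffter_entry n k \<pi> ((j + n - 0) mod n) 0 + heffter_entry n k \<pi> ((j + n - 1) mod n) 1 +
      heffter_entry n k \<pi> ((j + n - 2) mod n) 2"
    unfolding assms(4) by (rule sum_alternating_pairs) (use pair assms(4) in simp)
  also have "\<dots> = (if j = 1 then 2 * int n * int k + 1 else 0)"
  proof -
    have "3 \<le> n"
      using assms by simp
    consider "j = 0" | "j = 1" | "2 \<le> j"
      by linarith
    then show ?thesis
    proof cases
      case 1
      have "n - 1 - 1 = n - 2"
        by simp
      then show ?thesis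
        using 1 assms(1) \<open>3 \<le> n\<close> by (simp add: heffter_entry_def del: diff_diff_left)
    next
      case 2
      moreover have "(1 + n) mod n = 1"
        using \<open>3 \<le> n\<close> by (simp add: mod_if)
      ultimately show ?thesis
        using assms(1,3) \<open>3 \<le> n\<close> by (simp add: heffter_entry_def)
    next
      case 3
      then have "(j + n - 1) mod n = j - 1" "(j + n - 2) mod n = j - 2"
        using assms(2) by (simp_all add: mod_if)
      moreover have "j - 1 - 1 = j - 2"
        by simp
      ultimately show ?thesis
        using 3 assms(2) by (simp add: heffter_entry_def del: diff_diff_left)
    qed
  qed
  finally show ?thesis .
qed

section \<open>Every absolute value occurs\<close>

text \<open>The label of \<open>l\<close> enters offset \<open>2\<close> of row \<open>l\<close> and
  offset \<open>0\<close> of the next row; the parity of \<open>l\<close> decides which of them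
  carries which value.\<close>

lemma heffter_entry_path_label:
  assumes "odd n" "3 \<le> k" "l < n"
  shows "\<exists>i<n. \<exists>d<k. heffter_entry n k \<pi> i d = (2 * int n - 1 - \<pi> l) \<or>
      heffter_entry n k \<pi> i d = - (2 * int n - 1 - \<pi> l)"
    and "\<exists>i<n. \<exists>d<k. heffter_entry n k \<pi> i d = int n * int k - \<pi> l \<or>
      heffter_entry n k \<pi> i d = - (int n * int k - \<pi> l)"
proof -
  have "((l + 1) mod n + n - 1) mod n = l"
    using diagonal_shift[of 1 n l] assms by (cases "n = 1") (auto simp: add.commute)
  then have "heffter_entry n k \<pi> ((l + 1) mod n) 0 =
      (if even l then 2 * int n - 1 - \<pi> l else \<pi> l - int n * int k)"
    by (simp add: heffter_entry_def)
  moreover have "heffter_entry n k \<pi> l 2 =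
      (if even l then int n * int k - \<pi> l else \<pi> l - (2 * int n - 1))"
    by (simp add: heffter_entry_def)
  moreover have "(l + 1) mod n < n" "0 < k" "2 < k"
    using assms by auto
  ultimately show "\<exists>i<n. \<exists>d<k. heffter_entry n k \<pi> i d = (2 * int n - 1 - \<pi> l) \<or>
      heffter_entry n k \<pi> i d = - (2 * int n - 1 - \<pi> l)"
    and "\<exists>i<n. \<exists>d<k. heffter_entry n k \<pi> i d = int n * int k - \<pi> l \<or>
      heffter_entry n k \<pi> i d = - (int n * int k - \<pi> l)"
    using \<open>l < n\<close> by (metis minus_diff_eq)+
qed

lemma heffter_entry_staircase:
  fixes y :: nat
  assumes "3 + 4 * p \<le> n" "y < 4 * p * n"
  shows "\<exists>i<n. \<exists>d<3 + 4 * p. \<bar>heffter_entry n k \<pi> i d\<bar> = int (2 * n + y)"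
proof -
  define w where "w = y div (2 * n)"
  define u where "u = y mod (2 * n) div 2"
  have n: "0 < n"
    using assms by simp
  have w: "w < 2 * p"
    unfolding w_def using assms by (intro less_mult_imp_div_less) (simp add: algebra_simps)
  have "y mod (2 * n) < 2 * n"
    using n by simp
  then have u: "u < n"
    by (auto simp: u_def)
  have y: "y = 2 * n * w + y mod (2 * n)"
    by (simp add: w_def)
  show ?thesis
  proof (cases "even (y mod (2 * n))")
    case True
    let ?d = "3 + 2 * w"
    let ?i = "(u + n - ?d) mod n"
    have "(?i + ?d) mod n = u"
      using u w assms by (intro diagonal_unshift_row) auto
    moreover have "y mod (2 * n) = 2 * u"
      using True by (simp add: u_def)
    ultimately have "\<bar>heffter_entry n k \<pi> ?i ?d\<bar> = int (2 * n + y)"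
      using y unfolding heffter_entry_staircase_eq by (simp add: abs_mult power_abs)
    moreover have "?i < n" "?d < 3 + 4 * p"
      using n w by auto
    ultimately show ?thesis
      by blast
  next
    case False
    let ?d = "4 + 2 * w"
    \<comment> \<open>The shift is one less than \<open>?d\<close>, since \<open>u\<close> is the
      column of the row's preceding cell.\<close>
    let ?i = "(u + n - (3 + 2 * w)) mod n"
    have "(?i + (3 + 2 * w)) mod n = u"
      using u w assms by (intro diagonal_unshift_row) auto
    moreover have "y mod (2 * n) = 2 * u + 1"
      using False unfolding u_def by simp
    ultimately have "\<bar>heffter_entry n k \<pi> ?i ?d\<bar> = int (2 * n + y)"
      using y unfolding heffter_entry_staircase_eq by (simp add: abs_mult power_abs)
    moreover have "?i < n" "?d < 3 + 4 * p"
      using n w by auto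
    ultimately show ?thesis
      by blast
  qed
qed

lemma heffter_entry_surj:
  fixes x :: int
  assumes "odd n" "k = 3 + 4 * p" "k \<le> n"
    and labels: "\<And>q. 0 \<le> q \<Longrightarrow> q < int n \<Longrightarrow> \<exists>l<n. \<pi> l = q"
    and differences: "\<And>q. 1 \<le> q \<Longrightarrow> q < int n \<Longrightarrow> \<exists>l<n. 0 < l \<and> \<bar>\<pi> l - \<pi> (l - 1)\<bar> = q"
    and x: "1 \<le> x" "x \<le> int n * int k"
  shows "\<exists>i<n. \<exists>d<k. \<bar>heffter_entry n k \<pi> i d\<bar> = x"
proof -
  let ?N = "int n * int k"
  \<comment> \<open>These ranges come from the path differences, the small label values, the
    staircases, the cell \<open>(0, 1)\<close> and the large label values, in this order.\<close>
  consider "x < int n" | "int n \<le> x" "x < 2 * int n" | "2 * int n \<le> x" "x < ?N - int n"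
    | "x = ?N - int n" | "?N - int n < x"
    by linarith
  then show ?thesis
  proof cases
    case 1
    then obtain l where l: "l < n" "0 < l" "\<bar>\<pi> l - \<pi> (l - 1)\<bar> = x"
      using differences x by blast
    then have "\<bar>heffter_entry n k \<pi> l 1\<bar> = x"
      by (auto simp: heffter_entry_def)
    then show ?thesis
      using l assms(2) by (intro exI[of _ l] conjI exI[of _ 1]) auto
  next
    case 2
    then obtain l where "l < n" "\<pi> l = 2 * int n - 1 - x"
      using labels[of "2 * int n - 1 - x"] by auto
    then show ?thesis
      using heffter_entry_path_label(1)[of n k l \<pi>] assms(1,2) x by fastforce
  next
    case 3
    define y where "y = nat (x - 2 * int n)"
    have y: "int y = x - 2 * int n"
      using 3 by (simp add: y_def)
    then have "int y < int (4 * p * n)"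
      using 3 assms(2) by (simp add: algebra_simps)
    then have "y < 4 * p * n"
      by linarith
    then show ?thesis
      using heffter_entry_staircase[of p n y k \<pi>] assms(2,3) y by simp
  next
    case 4
    moreover have "\<bar>heffter_entry n k \<pi> 0 1\<bar> = ?N - int n"
      using assms(2) by (simp add: heffter_entry_def algebra_simps)
    ultimately show ?thesis
      using assms(2,3) by (intro exI[of _ 0] conjI exI[of _ 1]) auto
  next
    case 5
    then obtain l where "l < n" "\<pi> l = ?N - x"
      using labels[of "?N - x"] x by auto
    then show ?thesis
      using heffter_entry_path_label(2)[of n k l \<pi>] assms(1,2) x by fastforce
  qed
qed

theorem theorem4p2:
  fixes n k :: nat
  assumes "n mod 4 = 3" and "k mod 4 = 3" and "n > k" and "k \<ge> 3"
  shows "\<exists>A. is_heffter n k A"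
proof -
  define h where "h = (n + 1) div 4"
  have n: "n = 4 * h - 1" "int n = 4 * int h - 1" "0 < h" "odd n"
    using assms(1) unfolding h_def by presburger+
  obtain p where k: "k = 3 + 4 * p"
    using assms(2) by (metis add.commute mod_mult_div_eq)
  let ?\<pi> = "graceful_path h"
  have ends: "?\<pi> 0 + ?\<pi> (n - 1) = int n - 2"
    using graceful_path_ends[OF n(3)] n by (simp add: numeral_eq_Suc)
  have "is_heffter n k (diagonal_array n k (heffter_entry n k ?\<pi>))"
  proof (rule is_heffter_diagonal_array)
    show "(\<Sum>d<k. heffter_entry n k ?\<pi> i d) mod (2 * int n * int k + 1) = 0" if "i < n" for i
      using sum_heffter_entry_row[of n i ?\<pi> k p] n(4) that ends k by simp
    show "(\<Sum>d<k. heffter_entry n k ?\<pi> ((j + n - d) mod n) d) mod (2 * int n * int k + 1) = 0"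
      if "j < n" for j
      using sum_heffter_entry_col[of n j ?\<pi> k p] n(4) that ends k assms(3) by simp
    show "\<exists>i<n. \<exists>d<k. \<bar>heffter_entry n k ?\<pi> i d\<bar> = x" if "1 \<le> x" "x \<le> int n * int k" for x
      using that assms(3) graceful_path_surj[of _ h] graceful_path_differences[of _ h] n
      by (intro heffter_entry_surj[OF n(4) k]) auto
  qed (use assms in auto)
  then show ?thesis
    by blast
qed

end
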